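(* Let $B\subset\mathbb{R}^3$ be the unit ball centered at the origin and, for $k>0$, let $(\mathcal{K}_B^k)^*$ be the Neumann-Poincaré operator of $B$ for the Helmholtz operator $\Delta+k^2$. For each integer $n\ge 0$ let $\tau_{n,k}\in\mathbb{C}$ be the eigenvalue defined by $(\mathcal{K}_B^k)^*[Y_n^m]=\tau_{n,k}Y_n^m$ (independent of $m$, $-n\le m\le n$), and let $$c_{n,k}:=-\frac12\int_{-1}^1 e^{ik\sqrt{2(1-t)}}\,P_n(t)\,dt .$$ Then for every fixed $k>0$, for $n$ sufficiently large (i.e. as $n\to\infty$), $$\tau_{n,k}=\frac{1}{2(2n+1)}+\frac{i}{2}\,k\,c_{n,k}+\mathcal{O}\Big(\frac{k}{n^{3/2}}\Big),$$ where $$c_{n,k}=\mathcal{O}\Big(\frac{1}{\sqrt n}\Big).$$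
   Context: For $k>0$ put $G_k(\mathbf{x})=-\dfrac{e^{ik|\mathbf{x}|}}{4\pi|\mathbf{x}|}$, $\mathbf{x}\in\mathbb{R}^3\setminus\{0\}$. The Neumann-Poincaré operator $(\mathcal{K}_B^k)^*:H^{-1/2}(\partial B)\to H^{-1/2}(\partial B)$ is $$(\mathcal{K}_B^k)^*[\phi](\mathbf{x})=\mathrm{p.v.}\int_{\partial B}\frac{\partial G_k(\mathbf{x}-\mathbf{y})}{\partial\nu_{\mathbf{x}}}\,\phi(\mathbf{y})\,ds_{\mathbf{y}},\qquad \mathbf{x}\in\partial B,$$ where $\nu$ is the exterior unit normal to $\partial B$, the normal derivative is taken in $\mathbf{x}$, and p.v. denotes the Cauchy principal value. $Y_n^m$ ($n\ge 0$, $-n\le m\le n$) are the spherical harmonics of order $n$ and degree $m$ on $\partial B=\mathbb{S}^2$; each is an eigenfunction of $(\mathcal{K}_B^k)^*$ with eigenvalue independent of $m$. $P_n$ is the Legendre polynomial of order $n$ (normalized by $P_n(1)=1$). The $\mathcal{O}$-terms are understood for fixed $k$ as $n\to\infty$. *)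

theory Defs
  imports "HOL-Analysis.Analysis" "HOL-Computational_Algebra.Polynomial"
    "HOL-Library.Landau_Symbols"
begin

definition helmholtz_G :: "real \<Rightarrow> real^3 \<Rightarrow> complex" where
  "helmholtz_G k x =
     - exp (\<i> * of_real (k * norm x)) / of_real (4 * pi * norm x)"

definition spherical_point :: "real \<times> real \<Rightarrow> real^3" where
  "spherical_point = (\<lambda>(\<theta>, \<phi>). vector [sin \<theta> * cos \<phi>, sin \<theta> * sin \<phi>, cos \<theta>])"

text \<open>
  The surface measure \<open>ds\<close> of the unit sphere, in spherical coordinates;
  \<open>sin \<theta>\<close> is the norm of the cross product of the two partial derivatives of
  \<^const>\<open>spherical_point\<close>. It is a Borel measure on the whole space, concentrated
  on the sphere.
\<close>

definition sphere_surface :: "(real^3) measure" where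
  "sphere_surface =
     distr
       (density lborel
         (\<lambda>(\<theta>, \<phi>). ennreal (indicator ({0..pi} \<times> {0..2 * pi}) (\<theta>, \<phi>) * sin \<theta>)))
       borel spherical_point"

definition exterior_normal :: "real^3 \<Rightarrow> real^3" where
  "exterior_normal x = x"  \<comment> \<open>for \<open>x\<close> on the unit sphere centred at the origin\<close>

definition normal_derivative :: "(real^3 \<Rightarrow> complex) \<Rightarrow> real^3 \<Rightarrow> complex" where
  "normal_derivative u x = frechet_derivative u (at x) (exterior_normal x)"

text \<open>
  The Neumann-Poincare operator of the unit ball. The principal value removes from the
  sphere the part within distance \<open>\<epsilon>\<close> of \<open>x\<close>, and lets \<open>\<epsilon>\<close> tend to \<open>0\<close> from above.
  The values are only meaningful for \<open>x\<close> on the unit sphere.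
\<close>

definition neumann_poincare ::
    "real \<Rightarrow> (real^3 \<Rightarrow> complex) \<Rightarrow> real^3 \<Rightarrow> complex" where
  "neumann_poincare k f x =
     Lim (at_right 0) (\<lambda>\<epsilon>. LINT y:(- ball x \<epsilon>)|sphere_surface.
       normal_derivative (\<lambda>z. helmholtz_G k (z - y)) x * f y)"

text \<open>Rodrigues' formula.\<close>

definition legendre :: "nat \<Rightarrow> real poly" where
  "legendre n = smult (1 / (2 ^ n * fact n)) ((pderiv ^^ n) ([:-1, 0, 1:] ^ n))"

definition assoc_legendre :: "nat \<Rightarrow> nat \<Rightarrow> real \<Rightarrow> real" where
  "assoc_legendre n m t =
     (-1) ^ m * sqrt (1 - t\<^sup>2) ^ m * poly ((pderiv ^^ m) (legendre n)) t"

text \<open>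
  The orthonormal complex spherical harmonics with the Condon-Shortley phase, as functions
  of a point of the unit sphere: \<open>x $ 3\<close> is \<open>cos \<theta>\<close> and the argument of
  \<open>x $ 1 + \<i> * x $ 2\<close> is the azimuth \<open>\<phi>\<close>. At the poles the azimuth is irrelevant,
  because \<open>assoc_legendre n m\<close> vanishes there for \<open>m > 0\<close>.
\<close>

definition spherical_harmonic_nonneg :: "nat \<Rightarrow> nat \<Rightarrow> real^3 \<Rightarrow> complex" where
  "spherical_harmonic_nonneg n m x =
     of_real (sqrt ((2 * real n + 1) / (4 * pi) * (fact (n - m) / fact (n + m)))
       * assoc_legendre n m (x $ 3))
     * exp (\<i> * of_real (real m * Arg (Complex (x $ 1) (x $ 2))))"

definition spherical_harmonic :: "nat \<Rightarrow> int \<Rightarrow> real^3 \<Rightarrow> complex" where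
  "spherical_harmonic n m x =
     (if 0 \<le> m then spherical_harmonic_nonneg n (nat m) x
      else (-1) ^ nat (- m) * cnj (spherical_harmonic_nonneg n (nat (- m)) x))"

definition c_coeff :: "nat \<Rightarrow> real \<Rightarrow> complex" where
  "c_coeff n k =
     - (1 / 2) * integral {-1..1}
         (\<lambda>t. exp (\<i> * of_real (k * sqrt (2 * (1 - t)))) * of_real (poly (legendre n) t))"

end

theory Submission
  imports Defs "HOL-Complex_Analysis.Cauchy_Integral_Formula"
begin

text \<open>
  Evaluating the eigenvalue equation for the zonal harmonic at the north pole, and using the
  chord length \<open>r = \<bar>x - y\<bar>\<close> as variable on the sphere (so that the cosine of the polar angle is
  \<open>1 - r\<^sup>2 / 2\<close>), gives
  \<open>\<tau> n = 1/4 \<integral>\<^sub>0\<^sup>2 (1 - i k r) e\<^bsup>ikr\<^esup> p(r) dr\<close> with \<open>p(r) = P\<^sub>n (1 - r\<^sup>2 / 2)\<close>.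
  The term \<open>- i k r\<close> contributes \<open>i/2 k c\<close>, and \<open>\<integral> p = 2 / (2 n + 1)\<close> gives the leading term.
  What remains is \<open>1/4 \<integral> (e\<^bsup>ikr\<^esup> - 1) p\<close>. Both it and \<open>c\<close> have the form \<open>\<integral> G(r) r p(r) dr\<close>
  with \<open>G\<close> smooth on \<open>[0, 2]\<close>. In the variable \<open>r\<close> the Legendre equation reads
  \<open>((r - r\<^sup>3 / 4) p')' = - n (n + 1) r p\<close>, so two integrations by parts, without boundary terms,
  together with \<open>\<bar>P\<^sub>n\<bar> \<le> 1\<close> bound such integrals by \<open>O(1 / n\<^sup>2)\<close>, more than is needed.
\<close>

subsection \<open>Legendre polynomials\<close>

lemma poly_ext_iff: "p = q \<longleftrightarrow> (\<forall>x. poly p x = poly q x)" for p q :: "real poly"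
  by (simp add: poly_eq_poly_eq_iff[symmetric] fun_eq_iff)

lemma pderiv_funpow_diff: "(pderiv ^^ n) (p - q) = (pderiv ^^ n) p - (pderiv ^^ n) (q :: real poly)"
  by (induction n) (simp_all add: pderiv_diff)

text \<open>Leibniz' rule stops after two terms because \<open>X\<close> has constant derivative.
  Only \<open>pderiv X = 1\<close> is assumed, so \<open>X\<close> stays an opaque symbol instead of
  a coefficient list.\<close>

lemma pderiv_funpow_X_mult:
  fixes X u :: "real poly"
  assumes "pderiv X = 1"
  shows "(pderiv ^^ Suc n) (X * u) = X * (pderiv ^^ Suc n) u + smult (real (Suc n)) ((pderiv ^^ n) u)"
proof (induction n)
  case (Suc n)
  have "(pderiv ^^ Suc (Suc n)) (X * u)
      = pderiv (X * (pderiv ^^ Suc n) u + smult (real (Suc n)) ((pderiv ^^ n) u))"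
    by (subst Suc.IH[symmetric]) simp
  also have "\<dots> = X * (pderiv ^^ Suc (Suc n)) u + smult (real (Suc (Suc n))) ((pderiv ^^ Suc n) u)"
    using assms by (simp add: pderiv_add pderiv_mult pderiv_smult poly_ext_iff algebra_simps)
  finally show ?case .
qed (simp add: pderiv_mult assms)

lemma pderiv_funpow_X_mult_pderiv:
  fixes X u :: "real poly"
  assumes "pderiv X = 1"
  shows "(pderiv ^^ n) (X * pderiv u) = X * pderiv ((pderiv ^^ n) u) + smult (real n) ((pderiv ^^ n) u)"
proof (cases n)
  case (Suc m)
  then show ?thesis
    using pderiv_funpow_X_mult[OF assms, of m "pderiv u"] by (simp add: funpow_swap1)
qed simp

text \<open>With w = x^2 - 1, the power v = w^n satisfies w v' = 2 n x v. Differentiating this n + 1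
  times gives the Legendre equation for the n-th derivative \<open>Q\<close> of v, hence for its
  multiple \<open>legendre n\<close>.\<close>

lemma legendre_ode_poly:
  "([:0, 1:] * [:0, 1:] - 1) * pderiv (pderiv (legendre n)) + smult 2 ([:0, 1:] * pderiv (legendre n))
    = smult (real (n * (n + 1))) (legendre n)"
proof -
  define X where "X = [:0, 1 :: real:]"
  have DX: "pderiv X = 1"
    by (simp add: X_def pderiv_pCons)
  define w where "w = X * X - 1"
  have w: "[:-1, 0, 1:] = w"
    by (simp add: w_def X_def one_pCons)
  have Dw: "pderiv w = smult 2 X"
    by (simp add: w_def pderiv_diff pderiv_mult DX flip: mult_2)
      (simp add: X_def numeral_poly)
  define v where "v = w ^ n"
  define Q where "Q = (pderiv ^^ n) v"
  have vd: "w * pderiv v = smult (2 * real n) (X * v)"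
  proof (cases n)
    case (Suc m)
    then show ?thesis
      unfolding v_def pderiv_power Dw by (simp add: algebra_simps)
  qed (simp add: v_def)
  have Q1: "(pderiv ^^ Suc n) u = pderiv ((pderiv ^^ n) u)" for u :: "real poly"
    by simp
  have Q2: "(pderiv ^^ n) (pderiv v) = pderiv Q"
    by (simp add: Q_def funpow_swap1)
  \<comment> \<open>Only multiplication by \<open>X\<close> has a ready Leibniz rule, so
    \<open>w\<close> is broken up into two such multiplications.\<close>
  have split: "w * pderiv v = X * (X * pderiv v) - pderiv v"
    by (simp add: w_def algebra_simps)
  have L: "(pderiv ^^ Suc n) (w * pderiv v)
      = w * pderiv (pderiv Q) + smult (2 * real (Suc n)) (X * pderiv Q) + smult (real (n * (n + 1))) Q"
    unfolding split pderiv_funpow_diff pderiv_funpow_X_mult[OF DX] Q1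
      pderiv_funpow_X_mult_pderiv[OF DX] Q2
    by (simp add: pderiv_add pderiv_mult pderiv_smult DX w_def Q_def[symmetric])
      (simp add: poly_ext_iff algebra_simps)
  have R: "(pderiv ^^ Suc n) (smult (2 * real n) (X * v))
      = smult (2 * real n) (X * pderiv Q + smult (real (Suc n)) Q)"
    unfolding higher_pderiv_smult pderiv_funpow_X_mult[OF DX] Q1 by (simp add: Q_def)
  have "w * pderiv (pderiv Q) + smult 2 (X * pderiv Q) = smult (real (n * (n + 1))) Q"
  proof -
    have "w * pderiv (pderiv Q) = smult (2 * real n) (X * pderiv Q + smult (real (Suc n)) Q)
       - smult (2 * real (Suc n)) (X * pderiv Q) - smult (real (n * (n + 1))) Q"
      using L R vd by simp
    then show ?thesis
      by (simp add: poly_ext_iff algebra_simps)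
  qed
  then have "smult c (w * pderiv (pderiv Q) + smult 2 (X * pderiv Q)) = smult c (smult (real (n * (n + 1))) Q)" for c
    by simp
  moreover obtain c where "legendre n = smult c Q"
    by (simp add: legendre_def Q_def v_def w)
  ultimately show ?thesis
    unfolding X_def[symmetric] w_def[symmetric]
    by (simp add: pderiv_smult smult_add_right mult.commute)
qed

lemma legendre_ode:
  "(1 - t\<^sup>2) * poly (pderiv (pderiv (legendre n))) t - 2 * t * poly (pderiv (legendre n)) t
    + real (n * (n + 1)) * poly (legendre n) t = 0"
  using arg_cong[OF legendre_ode_poly[of n], of "\<lambda>p. poly p t"]
  by (simp add: algebra_simps power2_eq_square)

text \<open>Differentiate (x^2 - 1)^(n+2) twice, replace x^2 by w + 1, and apply the remaining n + 1
  derivatives.\<close>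

lemma pderiv_legendre_rec_poly:
  "pderiv (legendre (Suc (Suc n))) = smult (2 * real n + 3) (legendre (Suc n)) + pderiv (legendre n)"
proof -
  define X where "X = [:0, 1 :: real:]"
  have DX: "pderiv X = 1"
    by (simp add: X_def pderiv_pCons)
  define w where "w = X * X - 1"
  have w: "[:-1, 0, 1:] = w"
    by (simp add: w_def X_def one_pCons)
  have Dw: "pderiv w = smult 2 X"
    by (simp add: w_def pderiv_diff pderiv_mult DX flip: mult_2)
      (simp add: X_def numeral_poly)
  have D2: "pderiv (pderiv (w ^ Suc (Suc n)))
      = smult (2 * (real n + 2)) (smult (2 * real n + 3) (w ^ Suc n) + smult (2 * (real n + 1)) (w ^ n))"
  proof -
    have "pderiv (pderiv (w ^ Suc (Suc n)))
      = smult (2 * (real n + 2)) (w ^ Suc n + smult (2 * (real n + 1)) (X * X * w ^ n))"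
      by (simp add: pderiv_power Dw pderiv_smult pderiv_mult DX del: power_Suc)
        (simp add: algebra_simps poly_ext_iff)
    moreover have "X * X * w ^ n = w ^ Suc n + w ^ n"
      by (simp add: w_def algebra_simps)
    ultimately show ?thesis
      by (simp only:) (simp add: algebra_simps poly_ext_iff)
  qed
  have "pderiv ((pderiv ^^ Suc (Suc n)) (w ^ Suc (Suc n)))
     = (pderiv ^^ Suc n) (pderiv (pderiv (w ^ Suc (Suc n))))"
    by (simp add: funpow_swap1 del: power_Suc)
  also have "\<dots> = smult (2 * (real n + 2)) (smult (2 * real n + 3) ((pderiv ^^ Suc n) (w ^ Suc n))
      + smult (2 * (real n + 1)) (pderiv ((pderiv ^^ n) (w ^ n))))"
    unfolding D2 higher_pderiv_smult higher_pderiv_add by simp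
  finally have E: "pderiv ((pderiv ^^ Suc (Suc n)) (w ^ Suc (Suc n)))
     = smult (2 * (real n + 2)) (smult (2 * real n + 3) ((pderiv ^^ Suc n) (w ^ Suc n))
      + smult (2 * (real n + 1)) (pderiv ((pderiv ^^ n) (w ^ n))))" .
  \<comment> \<open>The Rodrigues constants; their ratios absorb the factors 2 (n + 2) and 2 (n + 1)
    that \<open>E\<close> brings in.\<close>
  define c where "c n = 1 / (2 ^ n * fact n :: real)" for n
  have c: "c (Suc n) * (2 * (real n + 1)) = c n" for n
  proof -
    have "(2 * (real n + 1)) / ((2 * (real n + 1)) * (2 ^ n * fact n)) = 1 / (2 ^ n * fact n)"
      by (rule nonzero_divide_mult_cancel_left) (simp add: add_nonneg_pos less_imp_neq[symmetric])
    then show ?thesis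
      by (simp add: c_def algebra_simps)
  qed
  have c1: "c (Suc (Suc n)) * (2 * (real n + 2)) = c (Suc n)"
    using c[of "Suc n"] by (simp add: add.commute)
  have leg: "legendre n = smult (c n) ((pderiv ^^ n) (w ^ n))" for n
    by (simp add: legendre_def w c_def)
  have s: "smult (c (Suc (Suc n))) (smult (2 * (real n + 2)) p) = smult (c (Suc n)) p"
      "smult (c (Suc n)) (smult (2 * (real n + 1)) p) = smult (c n) p" for p
    by (simp_all only: smult_smult c c1)
  show ?thesis
    unfolding leg pderiv_smult E s(1)
    unfolding smult_add_right s(2) by (simp add: mult.commute)
qed

lemma pderiv_legendre_rec:
  "poly (pderiv (legendre (Suc (Suc n)))) t
    = (2 * real n + 3) * poly (legendre (Suc n)) t + poly (pderiv (legendre n)) t"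
  by (simp add: pderiv_legendre_rec_poly)

lemma legendre_0 [simp]: "legendre 0 = 1"
  by (simp add: legendre_def)

lemma legendre_1 [simp]: "legendre (Suc 0) = [:0, 1:]"
  by (simp add: legendre_def pderiv_pCons)

section \<open>Endpoint values and the uniform bound\<close>

text \<open>The second-order coefficient of the Legendre equation vanishes at the endpoints, which
  ties the derivative there to the value and turns the derivative recurrence into one for endpoint
  values.\<close>

lemma pderiv_legendre_at_1: "poly (pderiv (legendre n)) 1 = real (n * (n + 1)) / 2 * poly (legendre n) 1"
  using legendre_ode[of 1 n] by simp

lemma pderiv_legendre_at_minus_1:
  "poly (pderiv (legendre n)) (- 1) = - (real (n * (n + 1)) / 2 * poly (legendre n) (- 1))"
  using legendre_ode[of "-1" n] by simp

lemma legendre_at_1: "poly (legendre n) 1 = 1"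
proof (induction n rule: induct_nat_012)
  case (ge2 n)
  have "(real n + 2) * (real n + 3) * poly (legendre (Suc (Suc n))) 1 = (real n + 2) * (real n + 3)"
    using pderiv_legendre_rec[of n 1] ge2 by (simp add: pderiv_legendre_at_1 field_simps)
  then show ?case
    by simp
qed auto

lemma legendre_at_minus_1: "poly (legendre n) (- 1) = (- 1) ^ n"
proof (induction n rule: induct_nat_012)
  case (ge2 n)
  have "(real n + 2) * (real n + 3) * poly (legendre (Suc (Suc n))) (- 1)
      = (real n + 2) * (real n + 3) * (- 1) ^ n"
    using pderiv_legendre_rec[of n "-1"] ge2 by (simp add: pderiv_legendre_at_minus_1 field_simps)
  then show ?case
    by simp
qed auto

text \<open>Sonin's argument: \<open>P\<^sup>2 + (1 - t\<^sup>2) P'\<^sup>2 / (n (n + 1))\<close> increases with \<open>\<bar>t\<bar>\<close>.\<close>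

lemma abs_legendre_le_1:
  assumes "\<bar>t\<bar> \<le> 1"
  shows "\<bar>poly (legendre n) t\<bar> \<le> 1"
proof (cases "n = 0")
  case False
  define N where "N = real (n * (n + 1))"
  have N: "N > 0"
    unfolding N_def of_nat_0_less_iff using False by simp
  define P P' P'' where "P = poly (legendre n)" and "P' = poly (pderiv (legendre n))"
    and "P'' = poly (pderiv (pderiv (legendre n)))"
  define F where "F t = P t ^ 2 + (1 - t\<^sup>2) * P' t ^ 2 / N" for t
  have dP: "(P has_real_derivative P' t) (at t)" "(P' has_real_derivative P'' t) (at t)" for t
    unfolding P_def P'_def P''_def by (rule poly_DERIV)+
  have F': "(F has_real_derivative 2 * t * P' t ^ 2 / N) (at t)" for t
  proof -
    have "(F has_real_derivative 2 * P t * P' t + ((1 - t\<^sup>2) * (2 * P' t * P'' t) - 2 * t * P' t ^ 2) / N) (at t)"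
      unfolding F_def
      using N by (auto intro!: derivative_eq_intros dP simp: field_simps power2_eq_square)
    \<comment> \<open>The first bracket on the right is the Legendre equation and vanishes; what is
      left has the sign of t.\<close>
    moreover have "2 * P t * P' t + ((1 - t\<^sup>2) * (2 * P' t * P'' t) - 2 * t * P' t ^ 2) / N
       = 2 * P' t / N * ((1 - t\<^sup>2) * P'' t - 2 * t * P' t + N * P t) + 2 * t * P' t ^ 2 / N"
      using N by (simp add: field_simps power2_eq_square)
    ultimately show ?thesis
      using legendre_ode[of t n] by (simp add: P_def P'_def P''_def N_def)
  qed
  have "F t \<le> 1"
  proof (cases "t \<ge> 0")
    case True
    have "F t \<le> F 1"
    proof (rule DERIV_nonneg_imp_nondecreasing[where f = F])
      show "\<exists>y. (F has_real_derivative y) (at x) \<and> 0 \<le> y" if "t \<le> x" for x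
      proof (rule exI, rule conjI[OF F'])
        have "2 * x \<ge> 0"
          using True that by simp
        then show "2 * x * P' x ^ 2 / N \<ge> 0"
          using N by simp
      qed
    qed (use assms in simp)
    then show ?thesis by (simp add: F_def P_def legendre_at_1)
  next
    case False
    have "F (-1) \<ge> F t"
    proof (rule DERIV_nonpos_imp_nonincreasing[where f = F])
      show "\<exists>y. (F has_real_derivative y) (at x) \<and> y \<le> 0" if "x \<le> t" for x
      proof (rule exI, rule conjI[OF F'])
        have "2 * x \<le> 0"
          using False that by simp
        then show "2 * x * P' x ^ 2 / N \<le> 0"
          using N by (intro divide_nonpos_pos mult_nonpos_nonneg[of "2 * x"]) simp_all
      qed
    qed (use assms in simp)
    moreover have "((- 1) ^ n)\<^sup>2 = (1 :: real)"
      by (metis power_even_eq power_minus1_even)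
    ultimately show ?thesis by (simp add: F_def P_def legendre_at_minus_1)
  qed
  moreover have "P t ^ 2 \<le> F t"
    using assms N unfolding F_def by (simp add: abs_square_le_1[symmetric])
  ultimately have "P t ^ 2 \<le> 1"
    by linarith
  then show ?thesis
    unfolding abs_square_le_1 P_def .
qed simp

subsection \<open>Legendre polynomials as functions of the chord length\<close>

lemma chord_param_bounds:
  fixes r :: real
  assumes "r \<in> {0..2}"
  shows "\<bar>1 - r\<^sup>2 / 2\<bar> \<le> 1"
proof -
  have "r\<^sup>2 \<le> 2\<^sup>2"
    using assms by (intro power_mono) auto
  then show ?thesis
    by (simp add: abs_le_iff)
qed

lemma has_real_derivative_poly_chord:
  "((\<lambda>r. poly p (1 - r\<^sup>2 / 2)) has_real_derivative - r * poly (pderiv p) (1 - r\<^sup>2 / 2)) (at r within S)"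
proof -
  have "((\<lambda>r. 1 - r\<^sup>2 / 2) has_real_derivative - r) (at r within S)" for r :: real
    by (auto intro!: derivative_eq_intros)
  from DERIV_chain2[OF poly_DERIV this] show ?thesis
    by (simp add: mult.commute)
qed

text \<open>With t = 1 - r^2 / 2 this weight is (1 - t^2) / r. It vanishes at r = 0 and at r =
  2.\<close>

lemma has_real_derivative_chord_weight:
  "((\<lambda>r. r - r ^ 3 / 4) has_real_derivative 1 - 3 * r\<^sup>2 / 4) (at r within S)" for r :: real
  by (auto intro!: derivative_eq_intros)

lemma legendre_chord_ode:
  fixes r :: real
  shows "((\<lambda>r. (r - r ^ 3 / 4) * (- r * poly (pderiv (legendre n)) (1 - r\<^sup>2 / 2)))
    has_real_derivative - real (n * (n + 1)) * r * poly (legendre n) (1 - r\<^sup>2 / 2)) (at r within S)"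
proof -
  let ?t = "1 - r\<^sup>2 / 2"
  have "((\<lambda>r. (r - r ^ 3 / 4) * (- r * poly (pderiv (legendre n)) (1 - r\<^sup>2 / 2))) has_real_derivative
     (1 - 3 * r\<^sup>2 / 4) * (- r * poly (pderiv (legendre n)) ?t)
     + (r - r ^ 3 / 4) * (- poly (pderiv (legendre n)) ?t + r\<^sup>2 * poly (pderiv (pderiv (legendre n))) ?t))
      (at r within S)"
    by (rule derivative_eq_intros has_real_derivative_chord_weight
        has_real_derivative_poly_chord refl)+ (simp add: algebra_simps power2_eq_square)
  also have "(1 - 3 * r\<^sup>2 / 4) * (- r * poly (pderiv (legendre n)) ?t)
     + (r - r ^ 3 / 4) * (- poly (pderiv (legendre n)) ?t + r\<^sup>2 * poly (pderiv (pderiv (legendre n))) ?t)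
    = r * ((1 - ?t\<^sup>2) * poly (pderiv (pderiv (legendre n))) ?t - 2 * ?t * poly (pderiv (legendre n)) ?t)"
    by (simp add: power2_eq_square power3_eq_cube field_simps)
  also have "\<dots> = - real (n * (n + 1)) * r * poly (legendre n) ?t"
    using arg_cong[OF legendre_ode[of ?t n], of "(*) r"] by (simp add: algebra_simps)
  finally show ?thesis .
qed

text \<open>
  Integrating the Legendre equation relates the integrals of \<open>P\<^sub>n\<close> and \<open>P\<^sub>n'\<close>
  against \<open>dr\<close>; the derivative recurrence then determines both by induction.
\<close>

lemma integral_legendre_chord:
  "integral {0..2} (\<lambda>r. poly (legendre n) (1 - r\<^sup>2 / 2)) = 2 / (2 * real n + 1)"
proof -
  define I where "I n = integral {0..2} (\<lambda>r. poly (legendre n) (1 - r\<^sup>2 / 2))" for n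
  define J where "J n = integral {0..2} (\<lambda>r. poly (pderiv (legendre n)) (1 - r\<^sup>2 / 2))" for n
  have int: "(\<lambda>r. poly p (1 - r\<^sup>2 / 2)) integrable_on {0..2}" for p :: "real poly"
    by (auto intro!: integrable_continuous_real continuous_intros)
  have IJ: "(2 * real n + 1)\<^sup>2 * I n = 4 * J n + 2 * (- 1) ^ n" for n
  proof -
    \<comment> \<open>The derivative of the second summand is n (n + 1) P - P' + r^2 P' / 4. The
      first summand cancels the last term and adds P / 4, completing n (n + 1) to (2 n + 1)^2 /
      4.\<close>
    let ?\<Phi> = "\<lambda>r::real. r / 4 * poly (legendre n) (1 - r\<^sup>2 / 2)
      + (r - r ^ 3 / 4) * poly (pderiv (legendre n)) (1 - r\<^sup>2 / 2)"
    have "(?\<Phi> has_real_derivative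
       (2 * real n + 1)\<^sup>2 / 4 * poly (legendre n) (1 - r\<^sup>2 / 2) - poly (pderiv (legendre n)) (1 - r\<^sup>2 / 2))
       (at r within {0..2})" for r
    proof -
      let ?t = "1 - r\<^sup>2 / 2"
      have "(?\<Phi> has_real_derivative
        r / 4 * (- r * poly (pderiv (legendre n)) ?t) + 1 / 4 * poly (legendre n) ?t
         + ((r - r ^ 3 / 4) * (- r * poly (pderiv (pderiv (legendre n))) ?t)
            + (1 - 3 * r\<^sup>2 / 4) * poly (pderiv (legendre n)) ?t)) (at r within {0..2})"
        by (intro DERIV_add DERIV_mult' has_real_derivative_chord_weight
            has_real_derivative_poly_chord) (auto intro!: derivative_eq_intros)
      also have "r / 4 * (- r * poly (pderiv (legendre n)) ?t) + 1 / 4 * poly (legendre n) ?t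
         + ((r - r ^ 3 / 4) * (- r * poly (pderiv (pderiv (legendre n))) ?t)
            + (1 - 3 * r\<^sup>2 / 4) * poly (pderiv (legendre n)) ?t)
        = poly (legendre n) ?t / 4 - poly (pderiv (legendre n)) ?t
         - ((1 - ?t\<^sup>2) * poly (pderiv (pderiv (legendre n))) ?t - 2 * ?t * poly (pderiv (legendre n)) ?t)"
        by (simp add: power2_eq_square power3_eq_cube field_simps)
      also have "\<dots> = (2 * real n + 1)\<^sup>2 / 4 * poly (legendre n) ?t - poly (pderiv (legendre n)) ?t"
        using legendre_ode[of ?t n] by (simp add: power2_eq_square algebra_simps)
      finally show ?thesis .
    qed
    then have "((\<lambda>r. (2 * real n + 1)\<^sup>2 / 4 * poly (legendre n) (1 - r\<^sup>2 / 2)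
        - poly (pderiv (legendre n)) (1 - r\<^sup>2 / 2)) has_integral ?\<Phi> 2 - ?\<Phi> 0) {0..2}"
      by (intro fundamental_theorem_of_calculus)
        (simp_all add: has_real_derivative_iff_has_vector_derivative)
    moreover have "((\<lambda>r. (2 * real n + 1)\<^sup>2 / 4 * poly (legendre n) (1 - r\<^sup>2 / 2)
        - poly (pderiv (legendre n)) (1 - r\<^sup>2 / 2)) has_integral (2 * real n + 1)\<^sup>2 / 4 * I n - J n) {0..2}"
      unfolding I_def J_def
      by (intro has_integral_diff has_integral_mult_right integrable_integral int)
    ultimately have "(2 * real n + 1)\<^sup>2 / 4 * I n - J n = ?\<Phi> 2 - ?\<Phi> 0"
      by (rule has_integral_unique[symmetric])
    then show ?thesis
      by (simp add: legendre_at_minus_1) (simp add: field_simps)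
  qed
  have J: "J (Suc (Suc n)) = (2 * real n + 3) * I (Suc n) + J n" for n
    unfolding I_def J_def pderiv_legendre_rec
    by (subst integral_add) (auto intro!: int integrable_on_mult_right)
  \<comment> \<open>This is n for even n and n + 1 for odd n: \<open>IJ\<close> and the value of J
    (n + 1) give (2 n + 3) I (n + 1) = 2, so \<open>J\<close> grows by 2 every two steps from J 0 =
    0 and J 1 = 2.\<close>
  have "J n = real n + (1 - (- 1) ^ n) / 2"
  proof (induction n rule: induct_nat_012)
    case (ge2 n)
    have "(2 * real n + 3) * ((2 * real n + 3) * I (Suc n)) = (2 * real n + 3) * 2"
      using IJ[of "Suc n"] ge2 by (simp add: field_simps power2_eq_square)
    moreover have "2 * real n + 3 > 0"
      by (simp add: add_nonneg_pos)
    ultimately have "(2 * real n + 3) * I (Suc n) = 2"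
      by (simp only: mult_cancel_left less_irrefl) simp
    then show ?case
      using J[of n] ge2 by simp
  qed (simp_all add: J_def pderiv_pCons)
  then have "(2 * real n + 1) * ((2 * real n + 1) * I n) = (2 * real n + 1) * 2"
    using IJ[of n] by (simp add: algebra_simps power2_eq_square add_divide_distrib diff_divide_distrib)
  moreover have "2 * real n + 1 > 0"
    by (simp add: add_nonneg_pos)
  ultimately have "(2 * real n + 1) * I n = 2"
    by (simp only: mult_cancel_left less_irrefl) simp
  then show ?thesis
    unfolding I_def[symmetric] by (simp add: field_simps)
qed

section \<open>Decay of integrals against Legendre polynomials\<close>

lemma legendre_chord_integral_bound:
  fixes G G' G'' :: "real \<Rightarrow> complex"
  assumes G: "\<And>r. r \<in> {0..2} \<Longrightarrow> (G has_vector_derivative G' r) (at r within {0..2})"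
    and G': "\<And>r. r \<in> {0..2} \<Longrightarrow> (G' has_vector_derivative G'' r) (at r within {0..2})"
    and G'': "continuous_on {0..2} G''"
  obtains C where "\<And>n. real (n * (n + 1)) *
    norm (integral {0..2} (\<lambda>r. G r * of_real (r * poly (legendre n) (1 - r\<^sup>2 / 2)))) \<le> C"
proof
  fix n
  \<comment> \<open>The derivative of the chord weight times \<open>G'\<close>. It does not depend
    on n, which makes the final bound uniform.\<close>
  define H where "H r = G'' r * of_real (r - r ^ 3 / 4) + G' r * of_real (1 - 3 * r\<^sup>2 / 4)" for r
  let ?p = "\<lambda>r. poly (legendre n) (1 - r\<^sup>2 / 2) :: real"
  let ?p' = "\<lambda>r. - r * poly (pderiv (legendre n)) (1 - r\<^sup>2 / 2) :: real"
  have cont: "continuous_on {0..2} G" "continuous_on {0..2} G'"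
    using continuous_on_vector_derivative[OF G] continuous_on_vector_derivative[OF G'] by blast+
  have contH: "continuous_on {0..2} H"
    unfolding H_def by (intro continuous_intros cont G'') auto
  let ?I = "integral {0..2} (\<lambda>r. G r * of_real (r * ?p r))"
  let ?K = "integral {0..2} (\<lambda>r. H r * of_real (?p r))"
  \<comment> \<open>Boundary expression of both integrations by parts at once; each summand contains
    the weight, so it vanishes at 0 and 2.\<close>
  let ?\<Phi> = "\<lambda>r. G r * of_real ((r - r ^ 3 / 4) * ?p' r) - G' r * of_real ((r - r ^ 3 / 4) * ?p r)"
  have "(?\<Phi> has_vector_derivative - (of_nat (n * (n + 1)) * (G r * of_real (r * ?p r)) + H r * of_real (?p r)))
     (at r within {0..2})" if "r \<in> {0..2}" for r
  proof -
    have 1: "((\<lambda>r. of_real ((r - r ^ 3 / 4) * ?p' r) :: complex) has_vector_derivative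
       of_real (- real (n * (n + 1)) * r * ?p r)) (at r within {0..2})"
      by (rule has_vector_derivative_of_real)
        (use legendre_chord_ode in \<open>simp add: has_real_derivative_iff_has_vector_derivative\<close>)
    have 2: "((\<lambda>r. of_real ((r - r ^ 3 / 4) * ?p r) :: complex) has_vector_derivative
       of_real ((r - r ^ 3 / 4) * ?p' r + (1 - 3 * r\<^sup>2 / 4) * ?p r)) (at r within {0..2})"
      by (rule has_vector_derivative_of_real)
        (intro DERIV_mult' has_real_derivative_chord_weight has_real_derivative_poly_chord)
    have "(?\<Phi> has_vector_derivative
      (G r * of_real (- real (n * (n + 1)) * r * ?p r) + G' r * of_real ((r - r ^ 3 / 4) * ?p' r))
      - (G' r * of_real ((r - r ^ 3 / 4) * ?p' r + (1 - 3 * r\<^sup>2 / 4) * ?p r) + G'' r * of_real ((r - r ^ 3 / 4) * ?p r)))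
      (at r within {0..2})"
      by (intro has_vector_derivative_diff has_vector_derivative_mult G G' 1 2 that)
    then show ?thesis
      by (rule back_subst[of "\<lambda>d. (?\<Phi> has_vector_derivative d) _"]) (simp add: H_def algebra_simps)
  qed
  then have "((\<lambda>r. - (of_nat (n * (n + 1)) * (G r * of_real (r * ?p r)) + H r * of_real (?p r)))
     has_integral ?\<Phi> 2 - ?\<Phi> 0) {0..2}"
    by (intro fundamental_theorem_of_calculus) auto
  moreover have "((\<lambda>r. - (of_nat (n * (n + 1)) * (G r * of_real (r * ?p r)) + H r * of_real (?p r)))
     has_integral - (of_nat (n * (n + 1)) * ?I + ?K)) {0..2}"
    by (intro has_integral_neg has_integral_add has_integral_mult_right integrable_integral
        integrable_continuous_real continuous_intros cont contH) auto
  ultimately have "- (of_nat (n * (n + 1)) * ?I + ?K) = ?\<Phi> 2 - ?\<Phi> 0"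
    by (rule has_integral_unique[symmetric])
  also have "\<dots> = 0"
    by simp
  finally have "of_nat (n * (n + 1)) * ?I = - ?K"
    by (simp only: neg_equal_0_iff_equal eq_neg_iff_add_eq_0)
  from arg_cong[OF this, of norm] have "real (n * (n + 1)) * norm ?I = norm ?K"
    by (simp only: norm_mult norm_of_nat norm_minus_cancel)
  also have "\<dots> \<le> integral {0..2} (\<lambda>r. norm (H r))"
  proof (rule integral_norm_bound_integral)
    fix r :: real assume "r \<in> {0..2}"
    then have "\<bar>?p r\<bar> \<le> 1"
      by (intro abs_legendre_le_1 chord_param_bounds)
    then show "norm (H r * of_real (?p r)) \<le> norm (H r)"
      by (simp add: norm_mult mult_left_le)
  qed (intro integrable_continuous_real continuous_intros contH; simp)+
  \<comment> \<open>The constant \<open>C\<close> is the integral of the norm of \<open>H\<close>,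
    written out because \<open>H\<close> is local to the fixed n.\<close>
  finally show "real (n * (n + 1)) * norm ?I \<le> integral {0..2}
     (\<lambda>r. norm (G'' r * of_real (r - r ^ 3 / 4) + G' r * of_real (1 - 3 * r\<^sup>2 / 4)))"
    unfolding H_def .
qed

text \<open>An entire function restricted to the real axis supplies both derivatives and their
  continuity.\<close>

lemma legendre_chord_integral_bound_entire:
  assumes "g holomorphic_on UNIV"
  obtains C where "\<And>n. real (n * (n + 1)) *
    norm (integral {0..2} (\<lambda>r. g (of_real r) * of_real (r * poly (legendre n) (1 - r\<^sup>2 / 2)))) \<le> C"
proof -
  have D: "((\<lambda>r. h (of_real r)) has_vector_derivative deriv h (of_real r)) (at r within {0..2})"
    if "h holomorphic_on UNIV" for h and r :: real
    using has_vector_derivative_real_field[of h "deriv h (of_real r)" r "{0..2}"] that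
    by (simp add: holomorphic_derivI)
  have hol: "deriv g holomorphic_on UNIV" "deriv (deriv g) holomorphic_on UNIV"
    using assms by (simp_all add: holomorphic_deriv)
  have "continuous_on {0..2} (\<lambda>r. deriv (deriv g) (of_real r))"
    using holomorphic_on_imp_continuous_on[OF hol(2)]
    by (rule continuous_on_compose2) (auto intro: continuous_intros)
  then show ?thesis
    by (rule legendre_chord_integral_bound[OF D[OF assms] D[OF hol(1)]]) (rule that)
qed

section \<open>Chord form of \<open>c_coeff\<close>, and the remainder integral\<close>

lemma integral_chord_substitution:
  fixes f :: "real \<Rightarrow> complex"
  assumes "continuous_on {-1..1} f"
  shows "integral {-1..1} f = integral {0..2} (\<lambda>r. f (1 - r\<^sup>2 / 2) * of_real r)"
proof -
  have img: "(\<lambda>r. 1 - r\<^sup>2 / 2) ` {0..2} \<subseteq> {-1..1 :: real}"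
    using chord_param_bounds by (force simp: abs_le_iff)
  \<comment> \<open>The substitution is decreasing: the first integral runs over an empty interval,
    and the remaining minus sign cancels that of - r.\<close>
  have "((\<lambda>r. - r *\<^sub>R f (1 - r\<^sup>2 / 2)) has_integral
      integral {1 - 0\<^sup>2 / 2..1 - 2\<^sup>2 / 2} f - integral {1 - 2\<^sup>2 / 2..1 - 0\<^sup>2 / 2} f) {0..2}"
    by (rule has_integral_substitution_general[of "{}", OF _ _ img assms])
      (auto intro!: derivative_eq_intros continuous_intros)
  then have "((\<lambda>r. - r *\<^sub>R f (1 - r\<^sup>2 / 2)) has_integral - integral {-1..1} f) {0..2}"
    by simp
  from has_integral_neg[OF this] show ?thesis
    by (simp add: integral_unique scaleR_conv_of_real mult.commute)
qed

text \<open>The root sqrt (2 (1 - t)) is the chord length r itself, so its singularity at t = 1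
  disappears.\<close>

lemma c_coeff_chord:
  assumes "k > 0"
  shows "c_coeff n k = - (1 / 2) *
    integral {0..2} (\<lambda>r. exp (\<i> * of_real (k * r)) * of_real (r * poly (legendre n) (1 - r\<^sup>2 / 2)))"
proof -
  have "continuous_on {-1..1}
    (\<lambda>t. exp (\<i> * of_real (k * sqrt (2 * (1 - t)))) * of_real (poly (legendre n) t))"
    by (intro continuous_intros)
  then show ?thesis
    unfolding c_coeff_def
    by (subst integral_chord_substitution) (auto intro!: integral_cong simp: mult_ac)
qed

lemma c_coeff_bound:
  assumes "k > 0"
  obtains C where "\<And>n. real (n * (n + 1)) * norm (c_coeff n k) \<le> C"
proof -
  obtain C where C: "real (n * (n + 1)) * norm (integral {0..2}
     (\<lambda>r. exp (\<i> * of_real k * of_real r) * of_real (r * poly (legendre n) (1 - r\<^sup>2 / 2)))) \<le> C" for n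
    by (rule legendre_chord_integral_bound_entire[of "\<lambda>z. exp (\<i> * of_real k * z)"])
      (intro holomorphic_intros, blast)
  have "real (n * (n + 1)) * norm (c_coeff n k) \<le> C / 2" for n
    using C[of n] unfolding c_coeff_chord[OF assms] norm_mult of_real_mult mult.assoc by simp
  then show ?thesis
    by (rule that)
qed

text \<open>The factor r demanded by the general bound is missing here; it is split off from the
  exponential difference, which vanishes at 0.\<close>

lemma exp_diff_chord_integral_bound:
  obtains C where "\<And>n. real (n * (n + 1)) * norm (integral {0..2}
     (\<lambda>r. (exp (\<i> * of_real (k * r)) - 1) * of_real (poly (legendre n) (1 - r\<^sup>2 / 2)))) \<le> C"
proof -
  define f where "f z = exp (\<i> * of_real k * z)" for z
  \<comment> \<open>The singularity of \<open>(f z - 1) / z\<close> at \<open>0\<close> is removable.\<close>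
  define g where "g z = (if z = 0 then deriv f 0 else (f z - f 0) / (z - 0))" for z
  have "f holomorphic_on UNIV"
    unfolding f_def by (intro holomorphic_intros)
  then have "g holomorphic_on UNIV"
    unfolding g_def by (rule pole_lemma) simp
  then obtain C where C: "real (n * (n + 1)) * norm (integral {0..2}
     (\<lambda>r. g (of_real r) * of_real (r * poly (legendre n) (1 - r\<^sup>2 / 2)))) \<le> C" for n
    by (rule legendre_chord_integral_bound_entire) blast
  \<comment> \<open>At r = 0 both sides are 0, whatever value \<open>g\<close> takes there.\<close>
  have eq: "g (of_real r) * of_real (r * x) = (exp (\<i> * of_real (k * r)) - 1) * of_real x" for r x
    by (simp add: g_def f_def mult.assoc)
  show ?thesis
    by (rule that[OF C[unfolded eq]])
qed

subsection \<open>The Neumann-Poincare operator at the north pole\<close>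

text \<open>The fundamental solution is radial, so its normal derivative is the radial one times the
  cosine between x - y and the normal x.\<close>

lemma normal_derivative_helmholtz:
  fixes x y :: "real^3"
  assumes "x \<noteq> y"
  defines "r \<equiv> norm (x - y)"
  shows "normal_derivative (\<lambda>z. helmholtz_G k (z - y)) x =
    of_real ((x - y) \<bullet> x / r) * ((1 - \<i> * of_real (k * r)) * exp (\<i> * of_real (k * r)) / of_real (4 * pi * r\<^sup>2))"
proof -
  define \<phi> where "\<phi> r = - exp (\<i> * of_real (k * r)) / of_real (4 * pi * r)" for r
  define D where "D = (1 - \<i> * of_real (k * r)) * exp (\<i> * of_real (k * r)) / of_real (4 * pi * r\<^sup>2)"
  have r: "r > 0"
    using assms by simp
  \<comment> \<open>The radial profile is differentiated as a complex function and then restricted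
    to the real axis.\<close>
  have "((\<lambda>z. - exp (\<i> * (of_real k * z)) / (4 * of_real pi * z)) has_field_derivative D) (at (of_real r))"
    using r by (auto intro!: derivative_eq_intros simp: D_def field_simps power2_eq_square)
  from has_vector_derivative_real_field[OF this, of UNIV]
  have "(\<phi> has_vector_derivative D) (at r)"
    by (simp add: \<phi>_def[abs_def])
  then have "(\<phi> has_derivative (\<lambda>h. h *\<^sub>R D)) (at (norm (x - y)))"
    by (simp add: has_vector_derivative_def r_def)
  moreover have "((\<lambda>z. z - y) has_derivative (\<lambda>h. h)) (at x)"
    by (auto intro!: derivative_eq_intros)
  then have "((\<lambda>z. norm (z - y)) has_derivative (\<lambda>h. h \<bullet> sgn (x - y))) (at x)"
    using has_derivative_compose[of "\<lambda>z. z - y" "\<lambda>h. h" x UNIV norm, OF _ has_derivative_norm[of "x - y"]] assms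
    by auto
  ultimately have deriv: "((\<lambda>z. \<phi> (norm (z - y))) has_derivative (\<lambda>h. (h \<bullet> sgn (x - y)) *\<^sub>R D)) (at x)"
    by (rule has_derivative_compose[rotated])
  then have "normal_derivative (\<lambda>z. helmholtz_G k (z - y)) x = (x \<bullet> sgn (x - y)) *\<^sub>R D"
    unfolding normal_derivative_def helmholtz_G_def \<phi>_def exterior_normal_def
    by (simp only: frechet_derivative_at[OF deriv[unfolded \<phi>_def], symmetric])
  also have "x \<bullet> sgn (x - y) = (x - y) \<bullet> x / r"
    by (simp add: sgn_div_norm r_def inner_commute divide_inverse mult.commute)
  finally show ?thesis
    by (simp add: D_def scaleR_conv_of_real)
qed

lemma spherical_point_nth [simp]:
  "spherical_point (\<theta>, \<phi>) $ 1 = sin \<theta> * cos \<phi>"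
  "spherical_point (\<theta>, \<phi>) $ 2 = sin \<theta> * sin \<phi>"
  "spherical_point (\<theta>, \<phi>) $ 3 = cos \<theta>"
  by (simp_all add: spherical_point_def)

lemma cos_conv_sin_half: "cos \<theta> = 1 - (2 * sin (\<theta> / 2))\<^sup>2 / 2" for \<theta> :: real
  using cos_double_sin[of "\<theta> / 2"] by (simp add: power_mult_distrib)

lemma north_pole_diff_inner: "(axis 3 1 - spherical_point (\<theta>, \<phi>)) \<bullet> axis 3 1 = 1 - cos \<theta>"
  by (simp add: inner_axis)

lemma norm_north_pole_diff:
  assumes "\<theta> \<in> {0..pi}"
  shows "norm (axis 3 1 - spherical_point (\<theta>, \<phi>)) = 2 * sin (\<theta> / 2)"
proof -
  have az: "(sin \<theta> * cos \<phi>)\<^sup>2 + (sin \<theta> * sin \<phi>)\<^sup>2 = (sin \<theta>)\<^sup>2 * ((sin \<phi>)\<^sup>2 + (cos \<phi>)\<^sup>2)"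
    by (simp only: power_mult_distrib distrib_left add.commute)
  have "(norm (axis 3 1 - spherical_point (\<theta>, \<phi>)))\<^sup>2 = (sin \<theta> * cos \<phi>)\<^sup>2 + (sin \<theta> * sin \<phi>)\<^sup>2 + (1 - cos \<theta>)\<^sup>2"
    by (simp add: norm_vec_def L2_set_def sum_3 axis_def)
  also have "\<dots> = 2 - 2 * cos \<theta>"
    unfolding az sin_cos_squared_add using sin_cos_squared_add[of \<theta>]
    by (simp add: power2_eq_square algebra_simps)
  also have "\<dots> = (2 * sin (\<theta> / 2))\<^sup>2"
    by (simp add: cos_conv_sin_half[of \<theta>])
  finally show ?thesis
    using assms by (subst (asm) power2_eq_iff_nonneg) (simp_all add: sin_ge_zero)
qed

text \<open>Fubini for an integrand whose azimuth enters only through an indicator; it produces the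
  factor 2 pi.\<close>

lemma lborel_integral_mult_indicator_snd:
  fixes a :: "real \<Rightarrow> complex"
  assumes "integrable lborel a" and [measurable]: "A \<in> sets lborel" and "emeasure lborel A < \<infinity>"
  shows "(LINT p|lborel. indicator A (snd p) *\<^sub>R a (fst p)) = measure lborel A *\<^sub>R (LINT \<theta>|lborel. a \<theta>)"
    (is "integral\<^sup>L _ ?f = _")
proof -
  have [measurable]: "a \<in> borel_measurable borel"
    using borel_measurable_integrable[OF assms(1)] by simp
  have "integrable (lborel \<Otimes>\<^sub>M lborel) (\<lambda>(x, y). indicator A y *\<^sub>R a x)"
  proof (rule lborel_pair.Fubini_integrable)
    have "integrable lborel (\<lambda>x. measure lborel A * norm (a x))"
      using assms by (intro integrable_mult_right integrable_norm)
    then show "integrable lborel (\<lambda>x. LINT y|lborel. norm (case (x, y) of (x, y) \<Rightarrow> indicator A y *\<^sub>R a x))"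
      using assms by simp
  qed (use assms in \<open>auto intro!: integrable_scaleR_left\<close>)
  from lborel_pair.integral_fst'[OF this] show ?thesis
    using assms by (simp add: lborel_prod split_beta')
qed

text \<open>From the pole, (x - y) \<bullet> x = r^2 / 2 and the surface element is r dr d\<phi>.
  This cancels the singularity of the kernel and leaves 1 / (8 pi), which the azimuth turns into 1 /
  4.\<close>

lemma truncated_sphere_integral:
  fixes x :: "real^3" and u :: "real \<Rightarrow> real"
  assumes \<epsilon>: "0 < \<epsilon>" "\<epsilon> < 2" and u: "continuous_on UNIV u"
  defines "x \<equiv> axis 3 1"
  shows "(LINT y:(- ball x \<epsilon>)|sphere_surface.
      normal_derivative (\<lambda>z. helmholtz_G k (z - y)) x * of_real (u (y $ 3)))
    = 1 / 4 * integral {\<epsilon>..2} (\<lambda>r. (1 - \<i> * of_real (k * r)) * exp (\<i> * of_real (k * r)) * of_real (u (1 - r\<^sup>2 / 2)))"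
proof -
  define K where "K y = of_real ((x - y) \<bullet> x / norm (x - y)) * ((1 - \<i> * of_real (k * norm (x - y)))
     * exp (\<i> * of_real (k * norm (x - y))) / of_real (4 * pi * (norm (x - y))\<^sup>2))" for y
  define F where "F r = (1 - \<i> * of_real (k * r)) * exp (\<i> * of_real (k * r)) * of_real (u (1 - r\<^sup>2 / 2)) / (8 * of_real pi)" for r
  \<comment> \<open>The polar angle at which the chord has length \<epsilon>.\<close>
  define \<theta>0 where "\<theta>0 = 2 * arcsin (\<epsilon> / 2)"
  define h where "h y = indicator (- ball x \<epsilon>) y *\<^sub>R (K y * of_real (u (y $ 3)))" for y
  \<comment> \<open>The factor cos (\<theta> / 2) is the Jacobian of r = 2 sin (\<theta> /
    2).\<close>
  define a where "a \<theta> = indicator {\<theta>0..pi} \<theta> *\<^sub>R (cos (\<theta> / 2) *\<^sub>R F (2 * sin (\<theta> / 2)))" for \<theta>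
  have [measurable]: "u \<in> borel_measurable borel"
    using u by (rule borel_measurable_continuous_onI)
  have [measurable]: "(\<lambda>y::real^3. y $ 3) \<in> borel_measurable borel"
    by (intro borel_measurable_continuous_onI continuous_intros)
  have [measurable]: "h \<in> borel_measurable borel"
    unfolding h_def K_def by measurable
  have sp [measurable]: "spherical_point \<in> borel_measurable borel"
  proof (rule borel_measurable_continuous_onI)
    have eq: "spherical_point = (\<lambda>p. \<chi> i. if i = 1 then sin (fst p) * cos (snd p)
        else if i = 2 then sin (fst p) * sin (snd p) else cos (fst p))"
      by (auto simp: vec_eq_iff forall_3)
    have "continuous_on UNIV (\<lambda>p::real \<times> real. if i = 1 then sin (fst p) * cos (snd p)
        else if i = 2 then sin (fst p) * sin (snd p) else cos (fst p))" for i :: 3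
      by (cases "i = 1"; cases "i = 2") (auto intro!: continuous_intros)
    then show "continuous_on UNIV spherical_point"
      unfolding eq by (rule continuous_on_vec_lambda)
  qed
  have F: "continuous_on S F" for S
    unfolding F_def by (auto intro!: continuous_intros continuous_on_compose2[OF u])
  have half: "0 \<le> \<epsilon> / 2" "\<epsilon> / 2 \<le> 1"
    using \<epsilon> by auto
  have \<theta>0: "0 \<le> \<theta>0" "\<theta>0 \<le> pi"
    unfolding \<theta>0_def using arcsin_bounded[of "\<epsilon> / 2"] arcsin_nonneg[of "\<epsilon> / 2"] half by auto
  have sin\<theta>0: "2 * sin (\<theta>0 / 2) = \<epsilon>"
    using half by (simp add: \<theta>0_def)
  have pt: "(indicator ({0..pi} \<times> {0..2 * pi}) p * sin (fst p)) *\<^sub>R h (spherical_point p)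
      = indicator {0..2 * pi} (snd p) *\<^sub>R a (fst p)" for p
  proof (cases p)
    case (Pair \<theta> \<phi>)
    show ?thesis
    proof (cases "\<theta> \<in> {0..pi}")
      case False
      then show ?thesis
        using \<theta>0 Pair by (auto simp: a_def)
    next
      case True
      define r where "r = 2 * sin (\<theta> / 2)"
      have nrm: "norm (x - spherical_point (\<theta>, \<phi>)) = r"
        using norm_north_pole_diff[OF True] by (simp add: x_def r_def)
      have inn: "(x - spherical_point (\<theta>, \<phi>)) \<bullet> x = r\<^sup>2 / 2"
        using north_pole_diff_inner[of \<theta> \<phi>] cos_conv_sin_half[of \<theta>] by (simp add: x_def r_def)
      have mem: "spherical_point (\<theta>, \<phi>) \<in> - ball x \<epsilon> \<longleftrightarrow> \<theta> \<in> {\<theta>0..pi}"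
      proof -
        have "spherical_point (\<theta>, \<phi>) \<in> - ball x \<epsilon> \<longleftrightarrow> sin (\<theta>0 / 2) \<le> sin (\<theta> / 2)"
          using nrm by (simp add: dist_norm r_def not_less flip: sin\<theta>0)
        also have "\<dots> \<longleftrightarrow> \<theta>0 / 2 \<le> \<theta> / 2"
          using True \<theta>0 by (intro sin_mono_le_eq) auto
        finally show ?thesis
          using True by auto
      qed
      show ?thesis
      proof (cases "\<theta> \<in> {\<theta>0..pi}")
        case False
        then show ?thesis
          using mem Pair by (simp add: h_def a_def)
      next
        case in\<theta>: True
        then have "r \<ge> \<epsilon>"
          using mem nrm by (simp add: dist_norm not_less)
        then have r: "r > 0"
          using \<epsilon> by simp
        have sin: "sin \<theta> = r * cos (\<theta> / 2)"
          using sin_double[of "\<theta> / 2"] by (simp add: r_def)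
        have cancel: "of_real (r * c) * (of_real (r\<^sup>2 / 2 / r) * (z / of_real (4 * pi * r\<^sup>2)) * w)
            = of_real c * (z * w / (8 * of_real pi))" for c and z w :: complex
          using r by (simp add: field_simps power2_eq_square)
        have "of_real (sin \<theta>) * (K (spherical_point (\<theta>, \<phi>)) * of_real (u (cos \<theta>)))
            = of_real (cos (\<theta> / 2)) * F r"
          unfolding K_def nrm inn sin F_def cos_conv_sin_half[of \<theta>] r_def[symmetric] by (rule cancel)
        then show ?thesis
          using True in\<theta> mem Pair
          by (simp add: h_def a_def r_def[symmetric] scaleR_conv_of_real indicator_def)
      qed
    qed
  qed
  have a_int: "set_integrable lborel {\<theta>0..pi} (\<lambda>\<theta>. cos (\<theta> / 2) *\<^sub>R F (2 * sin (\<theta> / 2)))"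
    by (intro borel_integrable_atLeastAtMost' continuous_intros continuous_on_compose2[OF F]) auto
  have "(LINT y:(- ball x \<epsilon>)|sphere_surface.
      normal_derivative (\<lambda>z. helmholtz_G k (z - y)) x * of_real (u (y $ 3))) = (LINT y|sphere_surface. h y)"
    unfolding set_lebesgue_integral_def h_def
  proof (intro Bochner_Integration.integral_cong refl)
    fix y
    show "indicat_real (- ball x \<epsilon>) y *\<^sub>R (normal_derivative (\<lambda>z. helmholtz_G k (z - y)) x * of_real (u (y $ 3)))
      = indicat_real (- ball x \<epsilon>) y *\<^sub>R (K y * of_real (u (y $ 3)))"
    \<comment> \<open>The kernel formula requires y to differ from x; the point y = x lies in the
      removed ball.\<close>
    proof (cases "y \<in> ball x \<epsilon>")
      case False
      then have "x \<noteq> y"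
        using \<epsilon> by auto
      then show ?thesis
        by (simp add: normal_derivative_helmholtz K_def)
    qed simp
  qed
  also have "\<dots> = (LINT p|density lborel (\<lambda>p. ennreal (indicator ({0..pi} \<times> {0..2 * pi}) p * sin (fst p))).
      h (spherical_point p))"
    unfolding sphere_surface_def split_beta' prod.collapse by (intro integral_distr) simp_all
  also have "\<dots> = (LINT p|lborel. (indicator ({0..pi} \<times> {0..2 * pi}) p * sin (fst p)) *\<^sub>R h (spherical_point p))"
  proof (rule integral_density)
    have [measurable]: "{0..pi} \<times> {0..2 * pi} \<in> sets (borel :: (real \<times> real) measure)"
      by (intro borel_closed closed_Times) auto
    have [measurable]: "(\<lambda>p. sin (fst p)) \<in> borel_measurable (borel :: (real \<times> real) measure)"
      by (intro borel_measurable_continuous_onI continuous_intros)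
    show "(\<lambda>p. indicator ({0..pi} \<times> {0..2 * pi}) p * sin (fst p)) \<in> borel_measurable lborel"
      by measurable
  qed (auto simp: indicator_def sin_ge_zero)
  also have "\<dots> = (LINT p|lborel. indicator {0..2 * pi} (snd p) *\<^sub>R a (fst p))"
    unfolding pt ..
  also have "\<dots> = 2 * pi * (LINT \<theta>|lborel. a \<theta>)"
    using a_int by (subst lborel_integral_mult_indicator_snd)
      (auto simp: set_integrable_def a_def[abs_def] scaleR_conv_of_real)
  also have "(LINT \<theta>|lborel. a \<theta>) = integral {\<theta>0..pi} (\<lambda>\<theta>. cos (\<theta> / 2) *\<^sub>R F (2 * sin (\<theta> / 2)))"
    using set_borel_integral_eq_integral(2)[OF a_int]
    by (simp add: a_def set_lebesgue_integral_def)
  also have "\<dots> = integral {2 * sin (\<theta>0 / 2)..2 * sin (pi / 2)} F"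
  \<comment> \<open>The interval from -2 to 2 contains every value of 2 sin (\<theta> / 2).\<close>
  proof (rule integral_unique, rule has_integral_substitution[where c = "-2" and d = 2])
    show "2 * sin (\<theta>0 / 2) \<le> 2 * sin (pi / 2)"
      by simp
    show "((\<lambda>\<theta>. 2 * sin (\<theta> / 2)) has_real_derivative cos (\<theta> / 2)) (at \<theta> within {\<theta>0..pi})" for \<theta>
      by (auto intro!: derivative_eq_intros)
    have "\<bar>sin (\<theta> / 2)\<bar> \<le> 1" for \<theta> :: real
      by (rule abs_sin_le_one)
    then show "(\<lambda>\<theta>. 2 * sin (\<theta> / 2)) ` {\<theta>0..pi} \<subseteq> {-2..2}"
      by (force simp: abs_le_iff)
  qed (use \<theta>0 F in auto)
  also have "\<dots> = integral {\<epsilon>..2} F"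
    by (simp add: sin\<theta>0)
  also have "2 * pi * \<dots> = 1 / 4 * integral {\<epsilon>..2} (\<lambda>r. (1 - \<i> * of_real (k * r)) * exp (\<i> * of_real (k * r)) * of_real (u (1 - r\<^sup>2 / 2)))"
    unfolding F_def integral_divide by simp
  finally show ?thesis .
qed

text \<open>In the chord variable the integrand is continuous up to r = 0, so the principal value is
  the limit of an indefinite integral at its endpoint.\<close>

lemma neumann_poincare_north_pole:
  fixes u :: "real \<Rightarrow> real"
  assumes u: "continuous_on UNIV u"
  shows "neumann_poincare k (\<lambda>y. of_real (u (y $ 3))) (axis 3 1)
    = 1 / 4 * integral {0..2} (\<lambda>r. (1 - \<i> * of_real (k * r)) * exp (\<i> * of_real (k * r)) * of_real (u (1 - r\<^sup>2 / 2)))"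
proof -
  define F where "F r = (1 - \<i> * of_real (k * r)) * exp (\<i> * of_real (k * r)) * of_real (u (1 - r\<^sup>2 / 2))" for r
  have "continuous_on {0..2} F"
    unfolding F_def by (auto intro!: continuous_intros continuous_on_compose2[OF u])
  then have "continuous_on {0..2} (\<lambda>\<epsilon>. 1 / 4 * integral {\<epsilon>..2} F)"
    by (intro continuous_intros indefinite_integral_continuous_1' integrable_continuous_real)
  then have "((\<lambda>\<epsilon>. 1 / 4 * integral {\<epsilon>..2} F) \<longlongrightarrow> 1 / 4 * integral {0..2} F) (at 0 within {0..2})"
    by (simp add: continuous_on_def)
  then have "((\<lambda>\<epsilon>. 1 / 4 * integral {\<epsilon>..2} F) \<longlongrightarrow> 1 / 4 * integral {0..2} F) (at_right 0)"
    by (simp add: at_within_Icc_at_right)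
  moreover have "\<forall>\<^sub>F \<epsilon> in at_right 0. 1 / 4 * integral {\<epsilon>..2} F =
     (LINT y:(- ball (axis 3 1) \<epsilon>)|sphere_surface.
      normal_derivative (\<lambda>z. helmholtz_G k (z - y)) (axis 3 1) * of_real (u (y $ 3)))"
    using eventually_at_right_real[of 0 2, simplified]
    by (rule eventually_mono) (use truncated_sphere_integral[OF _ _ u, of _ k] in \<open>simp add: F_def[abs_def]\<close>)
  ultimately show ?thesis
    unfolding neumann_poincare_def F_def[symmetric]
    by (intro tendsto_Lim trivial_limit_at_right_real) (rule Lim_transform_eventually)
qed

section \<open>The eigenvalue as an integral, and its asymptotics\<close>

lemma spherical_harmonic_zonal:
  "spherical_harmonic n 0 =
    (\<lambda>y. of_real (sqrt ((2 * real n + 1) / (4 * pi)) * poly (legendre n) (y $ 3)))"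
  by (simp add: spherical_harmonic_def spherical_harmonic_nonneg_def assoc_legendre_def fun_eq_iff)

text \<open>At the north pole the zonal harmonic equals its nonzero normalising constant, by which
  the eigenvalue equation can be divided.\<close>

lemma neumann_poincare_eigenvalue:
  assumes "\<And>x. x \<in> sphere 0 1 \<Longrightarrow>
    neumann_poincare k (spherical_harmonic n 0) x = \<tau> * spherical_harmonic n 0 x"
  shows "\<tau> = 1 / 4 * integral {0..2} (\<lambda>r. (1 - \<i> * of_real (k * r)) * exp (\<i> * of_real (k * r))
    * of_real (poly (legendre n) (1 - r\<^sup>2 / 2)))"
proof -
  define A where "A = sqrt ((2 * real n + 1) / (4 * pi))"
  have A: "A \<noteq> 0"
    by (auto simp: A_def)
  have cont: "continuous_on UNIV (\<lambda>t. A * poly (legendre n) t)"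
    by (intro continuous_intros)
  have "\<tau> * of_real A = neumann_poincare k (spherical_harmonic n 0) (axis 3 1)"
    by (subst assms) (simp_all add: spherical_harmonic_zonal legendre_at_1 A_def)
  also have "\<dots> = 1 / 4 * integral {0..2} (\<lambda>r. (1 - \<i> * of_real (k * r)) * exp (\<i> * of_real (k * r))
    * of_real (A * poly (legendre n) (1 - r\<^sup>2 / 2)))"
    unfolding spherical_harmonic_zonal A_def[symmetric] by (rule neumann_poincare_north_pole[OF cont])
  also have "\<dots> = 1 / 4 * integral {0..2} (\<lambda>r. (1 - \<i> * of_real (k * r)) * exp (\<i> * of_real (k * r))
    * of_real (poly (legendre n) (1 - r\<^sup>2 / 2))) * of_real A"
    by (simp only: of_real_mult mult.assoc flip: integral_mult_left) (simp only: ac_simps)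
  finally show ?thesis
    using A by simp
qed

text \<open>For n > 0, n^p \<le> n^2 \<le> n (n + 1), so quadratic decay yields every rate with
  exponent p \<le> 2.\<close>

lemma bigo_of_le_inverse_powr:
  fixes f :: "nat \<Rightarrow> complex"
  assumes bound: "\<And>n. real (n * (n + 1)) * norm (f n) \<le> C" and "p \<le> 2" "c > 0"
  shows "f \<in> O(\<lambda>n. of_real (c / real n powr p))"
proof (rule bigoI)
  show "\<forall>\<^sub>F n in sequentially. norm (f n) \<le> C / c * norm (of_real (c / real n powr p) :: complex)"
    using eventually_gt_at_top[of 0]
  proof eventually_elim
    case (elim n)
    have "real n powr p * norm (f n) \<le> real (n * (n + 1)) * norm (f n)"
    proof (rule mult_right_mono)
      have "real n powr p \<le> real n powr 2"
        using elim assms by (intro powr_mono) auto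
      also have "\<dots> \<le> real (n * (n + 1))"
        using elim by (simp add: power2_eq_square algebra_simps)
      finally show "real n powr p \<le> real (n * (n + 1))" .
    qed simp
    also have "\<dots> \<le> C"
      by (rule bound)
    finally show ?case
      using elim assms(3) by (simp add: norm_divide field_simps)
  qed
qed

theorem theorem3p2:
  fixes k :: real and \<tau> :: "nat \<Rightarrow> complex"
  assumes k_pos: "k > 0"
    and eigenvalue: "\<And>n m x. \<bar>m\<bar> \<le> int n \<Longrightarrow> x \<in> sphere 0 1 \<Longrightarrow>
      neumann_poincare k (spherical_harmonic n m) x = \<tau> n * spherical_harmonic n m x"
  shows "(\<lambda>n. \<tau> n - (1 / (2 * (2 * of_nat n + 1)) + \<i> / 2 * of_real k * c_coeff n k))
           \<in> O(\<lambda>n. of_real (k / real n powr (3 / 2)))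
       \<and> (\<lambda>n. c_coeff n k) \<in> O(\<lambda>n. of_real (1 / sqrt (real n)))"
proof
  obtain C where "real (n * (n + 1)) * norm (c_coeff n k) \<le> C" for n
    by (rule c_coeff_bound[OF k_pos]) blast
  from bigo_of_le_inverse_powr[OF this, of "1 / 2" 1]
  show "(\<lambda>n. c_coeff n k) \<in> O(\<lambda>n. of_real (1 / sqrt (real n)))"
    by (simp add: powr_half_sqrt)
next
  define R where "R n = integral {0..2}
     (\<lambda>r. (exp (\<i> * of_real (k * r)) - 1) * of_real (poly (legendre n) (1 - r\<^sup>2 / 2)))" for n
  \<comment> \<open>Exact for every n: (1 - i k r) e = 1 + (e - 1) - i k r e with e = exp (i k r).
    Integrated against p, the three terms give 2 / (2 n + 1), \<open>R n\<close> and 2 i k c, each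
    then divided by 4.\<close>
  have eq: "\<tau> n - (1 / (2 * (2 * of_nat n + 1)) + \<i> / 2 * of_real k * c_coeff n k) = R n / 4" for n
  proof -
    let ?p = "\<lambda>r. poly (legendre n) (1 - r\<^sup>2 / 2) :: real"
    have cont: "continuous_on {0..2} ?p"
      by (auto intro!: continuous_intros)
    have "((\<lambda>r. of_real (?p r)) has_integral (of_real (2 / (2 * real n + 1)) :: complex)) {0..2}"
      unfolding integral_legendre_chord[symmetric]
      by (intro has_integral_of_real integrable_integral integrable_continuous_real cont)
    moreover have "((\<lambda>r. (exp (\<i> * of_real (k * r)) - 1) * of_real (?p r)) has_integral R n) {0..2}"
      unfolding R_def by (intro integrable_integral integrable_continuous_real continuous_intros cont)
    moreover have "((\<lambda>r. - \<i> * of_real k * (exp (\<i> * of_real (k * r)) * of_real (r * ?p r))) has_integral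
       - \<i> * of_real k * (- 2 * c_coeff n k)) {0..2}"
      unfolding c_coeff_chord[OF k_pos]
      by (intro has_integral_mult_right)
        (simp, intro integrable_integral integrable_continuous_real continuous_intros cont)
    ultimately have "((\<lambda>r. of_real (?p r) + (exp (\<i> * of_real (k * r)) - 1) * of_real (?p r)
        + - \<i> * of_real k * (exp (\<i> * of_real (k * r)) * of_real (r * ?p r))) has_integral
       of_real (2 / (2 * real n + 1)) + R n + - \<i> * of_real k * (- 2 * c_coeff n k)) {0..2}"
      by (intro has_integral_add)
    then have "((\<lambda>r. (1 - \<i> * of_real (k * r)) * exp (\<i> * of_real (k * r)) * of_real (?p r)) has_integral
       of_real (2 / (2 * real n + 1)) + R n + - \<i> * of_real k * (- 2 * c_coeff n k)) {0..2}"
      by (rule has_integral_eq[rotated]) (simp add: algebra_simps)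
    moreover have "\<tau> n = 1 / 4 * integral {0..2} (\<lambda>r. (1 - \<i> * of_real (k * r)) * exp (\<i> * of_real (k * r))
      * of_real (?p r))"
      by (rule neumann_poincare_eigenvalue) (use eigenvalue in simp)
    ultimately have "\<tau> n = 1 / 4 * (of_real (2 / (2 * real n + 1)) + R n + - \<i> * of_real k * (- 2 * c_coeff n k))"
      by (simp add: integral_unique)
    then show ?thesis
      by (simp add: algebra_simps)
  qed
  obtain C where "real (n * (n + 1)) * norm (R n) \<le> C" for n
    unfolding R_def by (rule exp_diff_chord_integral_bound) blast
  \<comment> \<open>As k is fixed and positive, the factor k in the rate is absorbed into the
    constant.\<close>
  from bigo_of_le_inverse_powr[OF this, of "3 / 2" k] k_pos
  have "R \<in> O(\<lambda>n. of_real (k / real n powr (3 / 2)))"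
    by simp
  then show "(\<lambda>n. \<tau> n - (1 / (2 * (2 * of_nat n + 1)) + \<i> / 2 * of_real k * c_coeff n k))
     \<in> O(\<lambda>n. of_real (k / real n powr (3 / 2)))"
    unfolding eq by simp
qed

end
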